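(* Let $n\geq 1$ and $r\geq 0$ be integers and $L_n^{\langle r\rangle}(x)=\sum_{j=0}^{n}\binom{n-j+r}{n-j}\frac{x^j}{j!}$. (i) If $\gcd\!\left(n,\binom{n+r}{r}\right)=1$, then $L_n^{\langle r\rangle}(x)$ is irreducible over $\mathbb{Q}$. (ii) If $\gcd(n,r!)=1$, then $L_n^{\langle r\rangle}(x)$ is irreducible over $\mathbb{Q}$. *)

theory Defs
  imports "HOL-Computational_Algebra.Polynomial"
begin

text \<open>
  The subtraction \<open>n - j\<close> takes place in the natural numbers; it never truncates,
  because \<open>j \<le> n\<close> throughout the sum.
\<close>

definition gen_laguerre :: "nat \<Rightarrow> nat \<Rightarrow> rat poly" where
  "gen_laguerre n r = (\<Sum>j=0..n. monom (of_nat ((n - j + r) choose (n - j)) / fact j) j)"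

end

theory Submission
  imports Defs "HOL-Computational_Algebra.Primes"
begin

text \<open>
  The argument is Coleman's, via Newton polygons. Let \<open>p\<close> be a prime divisor of \<open>n\<close>. Since
  \<open>p\<close> does not divide \<open>(n + r) choose r\<close>, adding \<open>n\<close> and \<open>r\<close> in base \<open>p\<close> produces no carry, and
  therefore the \<open>p\<close>-adic Newton polygon is that of the truncated exponential
  series: its slopes are \<open>(p ^ T - 1) / ((p - 1) * p ^ T)\<close>, where \<open>p ^ T\<close> runs through the places
  of the nonzero digits of \<open>n\<close>. So the denominator of every slope is
  divisible by the full power of \<open>p\<close> dividing \<open>n\<close>. The slopes of a factor are among those of the
  product, and the vertices of its polygon are lattice points; hence that power of \<open>p\<close>
  divides the degree of every factor. Altogether \<open>n\<close> divides the degree of every factor.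
\<close>

section \<open>Newton polygons\<close>

text \<open>The value at 0 should be infinite and is left unspecified, hence the guards against
  zero. Integer values make the vertices of Newton polygons lattice points.\<close>

locale int_valuation =
  fixes v :: "'a :: idom \<Rightarrow> int"
  assumes val_mult: "x \<noteq> 0 \<Longrightarrow> y \<noteq> 0 \<Longrightarrow> v (x * y) = v x + v y"
    and val_add: "x \<noteq> 0 \<Longrightarrow> y \<noteq> 0 \<Longrightarrow> x + y \<noteq> 0 \<Longrightarrow> min (v x) (v y) \<le> v (x + y)"
begin

section \<open>Ultrametric estimates for finite sums\<close>

lemma val_minus: "v (- x) = v x"
proof (cases "x = 0")
  case False
  have "v (1 * 1) = v 1 + v 1" "v ((-1) * (-1)) = v (-1) + v (-1)"
    by (rule val_mult; simp)+
  hence "v (-1) = 0" by simp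
  moreover have "v ((-1) * x) = v (-1) + v x"
    by (rule val_mult) (use False in auto)
  ultimately show ?thesis by simp
qed simp

lemma val_sum_ge:
  fixes c :: real
  assumes "\<And>i. i \<in> A \<Longrightarrow> f i \<noteq> 0 \<Longrightarrow> c \<le> v (f i)" "sum f A \<noteq> 0"
  shows "c \<le> v (sum f A)"
  using assms
proof (induction A rule: infinite_finite_induct)
  case (insert a A)
  consider "f a = 0" | "sum f A = 0" | "f a \<noteq> 0" "sum f A \<noteq> 0" by blast
  thus ?case
  proof cases
    case 3
    hence "min (v (f a)) (v (sum f A)) \<le> v (f a + sum f A)"
      using insert by (intro val_add) auto
    moreover have "c \<le> v (f a)" "c \<le> v (sum f A)"
      using insert 3 by auto
    ultimately show ?thesis using insert by (auto simp: min_def split: if_splits)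
  qed (use insert in auto)
qed auto

text \<open>Integrality of \<open>v\<close> turns the strict bound by \<open>c\<close> into the weak
  bound by the next integer above \<open>c\<close>.\<close>

lemma val_sum_gt:
  fixes c :: real
  assumes "\<And>i. i \<in> A \<Longrightarrow> f i \<noteq> 0 \<Longrightarrow> c < v (f i)" "sum f A \<noteq> 0"
  shows "c < v (sum f A)"
proof -
  have "real_of_int (\<lfloor>c\<rfloor> + 1) \<le> v (sum f A)"
  proof (rule val_sum_ge)
    fix i assume "i \<in> A" "f i \<noteq> 0"
    hence "c < v (f i)" by (rule assms)
    hence "\<lfloor>c\<rfloor> < v (f i)" by (simp add: floor_less_iff)
    thus "real_of_int (\<lfloor>c\<rfloor> + 1) \<le> v (f i)" by linarith
  qed fact
  thus ?thesis by linarith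
qed

lemma val_add_dominant:
  assumes "x \<noteq> 0" "y \<noteq> 0 \<Longrightarrow> v x < v y"
  shows "x + y \<noteq> 0 \<and> v (x + y) = v x"
proof (cases "y = 0")
  case False
  have ne: "x + y \<noteq> 0"
  proof
    assume "x + y = 0"
    hence "y = - x" by (simp add: add_eq_0_iff)
    thus False using assms False val_minus by auto
  qed
  moreover have "min (v x) (v y) \<le> v (x + y)"
    using assms(1) False ne by (rule val_add)
  \<comment> \<open>Recovering \<open>x\<close> from \<open>x + y\<close> and \<open>- y\<close>:
    since \<open>v x < v y\<close>, the minimum can only be \<open>v (x + y)\<close>, which bounds
    it above by \<open>v x\<close>.\<close>
  moreover have "min (v (x + y)) (v (- y)) \<le> v (x + y + - y)"
    by (rule val_add) (use assms(1) False ne in auto)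
  ultimately show ?thesis using assms(2)[OF False] by (auto simp: val_minus)
qed (use assms in auto)

text \<open>This is where the line of slope \<open>- lam\<close> through the point
  \<open>(i, v (coeff f i))\<close> meets the vertical axis.\<close>

definition height :: "'a poly \<Rightarrow> real \<Rightarrow> nat \<Rightarrow> real" where
  "height f lam i = real_of_int (v (coeff f i)) + lam * real i"

text \<open>
  The line of slope \<open>- lam\<close> through the point \<open>(k, v (coeff f k))\<close> supports the Newton polygon
  of \<open>f\<close>.
\<close>

definition supporting :: "'a poly \<Rightarrow> real \<Rightarrow> nat \<Rightarrow> bool" where
  "supporting f lam k \<longleftrightarrow>
     coeff f k \<noteq> 0 \<and> (\<forall>i. coeff f i \<noteq> 0 \<longrightarrow> height f lam k \<le> height f lam i)"

text \<open>Left and right end coincide exactly when the supporting line touches the polygon in one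
  vertex; otherwise they bound an edge.\<close>

definition left_end :: "'a poly \<Rightarrow> real \<Rightarrow> nat \<Rightarrow> bool" where
  "left_end f lam k \<longleftrightarrow>
     supporting f lam k \<and> (\<forall>i<k. coeff f i \<noteq> 0 \<longrightarrow> height f lam k < height f lam i)"

definition right_end :: "'a poly \<Rightarrow> real \<Rightarrow> nat \<Rightarrow> bool" where
  "right_end f lam k \<longleftrightarrow>
     supporting f lam k \<and> (\<forall>i>k. coeff f i \<noteq> 0 \<longrightarrow> height f lam k < height f lam i)"

lemma ends_exist:
  assumes "f \<noteq> 0"
  obtains k l where "left_end f lam k" "right_end f lam l"
proof -
  define S where "S = {i. coeff f i \<noteq> 0}"
  have "S \<subseteq> {..degree f}" by (auto simp: S_def le_degree)
  hence finS: "finite S" by (rule finite_subset) simp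
  have "degree f \<in> S" using assms by (simp add: S_def)
  then obtain m where m: "m \<in> S" "\<And>i. i \<in> S \<Longrightarrow> height f lam m \<le> height f lam i"
    using arg_min_if_finite[OF finS, of "height f lam"] by (metis empty_iff not_le)
  define M where "M = {i. supporting f lam i}"
  have "m \<in> M" using m by (auto simp: M_def S_def supporting_def)
  moreover have "finite M"
    by (rule finite_subset[OF _ finS]) (auto simp: M_def S_def supporting_def)
  ultimately have "Min M \<in> M" "Max M \<in> M" and *: "\<And>i. i \<in> M \<Longrightarrow> Min M \<le> i \<and> i \<le> Max M"
    by (auto intro: Min_in Max_in)
  have aux: "height f lam k < height f lam i"
    if "k \<in> M" "i \<notin> M" "coeff f i \<noteq> 0" for i k
    using that unfolding M_def supporting_def mem_Collect_eq by (meson linorder_not_le order_trans)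
  have "left_end f lam (Min M)"
    unfolding left_end_def
  proof (intro conjI allI impI)
    fix i assume "i < Min M" "coeff f i \<noteq> 0"
    thus "height f lam (Min M) < height f lam i"
      using * by (intro aux[OF \<open>Min M \<in> M\<close>]) (auto simp: not_le[symmetric])
  qed (use \<open>Min M \<in> M\<close> in \<open>simp add: M_def\<close>)
  moreover have "right_end f lam (Max M)"
    unfolding right_end_def
  proof (intro conjI allI impI)
    fix i assume "i > Max M" "coeff f i \<noteq> 0"
    thus "height f lam (Max M) < height f lam i"
      using * by (intro aux[OF \<open>Max M \<in> M\<close>]) (auto simp: not_le[symmetric])
  qed (use \<open>Max M \<in> M\<close> in \<open>simp add: M_def\<close>)
  ultimately show ?thesis by (rule that)
qed

section \<open>Newton polygons of products\<close>

lemma height_mult_term: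
  assumes "coeff g i \<noteq> 0" "coeff h (m - i) \<noteq> 0" "i \<le> m"
  shows "real_of_int (v (coeff g i * coeff h (m - i))) + lam * real m = height g lam i + height h lam (m - i)"
proof -
  have "lam * real m = lam * real i + lam * real (m - i)"
    using assms(3) by (simp add: of_nat_diff algebra_simps)
  thus ?thesis using assms by (simp add: height_def val_mult)
qed

text \<open>In the convolution for coefficient \<open>k + l\<close> the term of \<open>k\<close> and
  \<open>l\<close> has strictly least valuation, so nothing cancels it. Every term of any other
  coefficient is bounded below by the sum of the two minimal heights.\<close>

lemma supporting_mult:
  assumes k: "supporting g lam k" and l: "supporting h lam l"
    and strict: "\<And>i. i \<le> k + l \<Longrightarrow> i \<noteq> k \<Longrightarrow> coeff g i \<noteq> 0 \<Longrightarrow> coeff h (k + l - i) \<noteq> 0 \<Longrightarrow>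
        height g lam k + height h lam l < height g lam i + height h lam (k + l - i)"
  shows "supporting (g * h) lam (k + l)"
proof -
  let ?t = "\<lambda>m i. coeff g i * coeff h (m - i)"
  define W where "W = height g lam k + height h lam l"
  have kl: "coeff g k \<noteq> 0" "coeff h l \<noteq> 0" using k l by (auto simp: supporting_def)
  have split: "coeff (g * h) (k + l) = ?t (k + l) k + (\<Sum>i\<in>{..k+l} - {k}. ?t (k + l) i)"
    unfolding coeff_mult by (rule sum.remove) auto
  have main: "real_of_int (v (?t (k + l) k)) + lam * real (k + l) = W"
    using height_mult_term[of g k h "k + l" lam] kl by (simp add: W_def)
  have "?t (k + l) k + (\<Sum>i\<in>{..k+l} - {k}. ?t (k + l) i) \<noteq> 0 \<and>
        v (?t (k + l) k + (\<Sum>i\<in>{..k+l} - {k}. ?t (k + l) i)) = v (?t (k + l) k)"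
  proof (rule val_add_dominant)
    assume ne: "(\<Sum>i\<in>{..k+l} - {k}. ?t (k + l) i) \<noteq> 0"
    have "W - lam * real (k + l) < v (\<Sum>i\<in>{..k+l} - {k}. ?t (k + l) i)"
    proof (rule val_sum_gt[OF _ ne])
      fix i assume i: "i \<in> {..k+l} - {k}" "?t (k + l) i \<noteq> 0"
      hence "W < height g lam i + height h lam (k + l - i)"
        unfolding W_def by (intro strict) auto
      also have "\<dots> = real_of_int (v (?t (k + l) i)) + lam * real (k + l)"
        by (rule height_mult_term[symmetric]) (use i in auto)
      finally show "W - lam * real (k + l) < v (?t (k + l) i)" by simp
    qed
    thus "v (?t (k + l) k) < v (\<Sum>i\<in>{..k+l} - {k}. ?t (k + l) i)"
      using main by linarith
  qed (use kl in auto)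
  hence top: "coeff (g * h) (k + l) \<noteq> 0" "height (g * h) lam (k + l) = W"
    using main unfolding height_def split by auto
  have "W \<le> height (g * h) lam m" if m: "coeff (g * h) m \<noteq> 0" for m
  proof -
    have "W - lam * real m \<le> v (\<Sum>i\<le>m. ?t m i)"
    proof (rule val_sum_ge)
      fix i assume i: "i \<in> {..m}" "?t m i \<noteq> 0"
      have "W \<le> height g lam i + height h lam (m - i)"
        unfolding W_def using k l i by (intro add_mono) (auto simp: supporting_def)
      also have "\<dots> = real_of_int (v (?t m i)) + lam * real m"
        by (rule height_mult_term[symmetric]) (use i in auto)
      finally show "W - lam * real m \<le> v (?t m i)" by simp
    qed (use m in \<open>simp add: coeff_mult\<close>)
    thus ?thesis by (simp add: height_def coeff_mult)
  qed
  thus ?thesis using top by (auto simp: supporting_def)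
qed

lemma supporting_mult_left:
  assumes "left_end g lam k" "left_end h lam l"
  shows "supporting (g * h) lam (k + l)"
proof (rule supporting_mult)
  fix i assume i: "i \<le> k + l" "i \<noteq> k" "coeff g i \<noteq> 0" "coeff h (k + l - i) \<noteq> 0"
  show "height g lam k + height h lam l < height g lam i + height h lam (k + l - i)"
  proof (cases "i < k")
    case True
    thus ?thesis using assms i by (intro add_less_le_mono) (auto simp: left_end_def supporting_def)
  next
    case False
    with i have "k + l - i < l" by linarith
    thus ?thesis using assms i by (intro add_le_less_mono) (auto simp: left_end_def supporting_def)
  qed
qed (use assms in \<open>auto simp: left_end_def\<close>)

lemma supporting_mult_right:
  assumes "right_end g lam k" "right_end h lam l"
  shows "supporting (g * h) lam (k + l)"
proof (rule supporting_mult)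
  fix i assume i: "i \<le> k + l" "i \<noteq> k" "coeff g i \<noteq> 0" "coeff h (k + l - i) \<noteq> 0"
  show "height g lam k + height h lam l < height g lam i + height h lam (k + l - i)"
  proof (cases "k < i")
    case True
    thus ?thesis using assms i by (intro add_less_le_mono) (auto simp: right_end_def supporting_def)
  next
    case False
    with i have "l < k + l - i" by linarith
    thus ?thesis using assms i by (intro add_le_less_mono) (auto simp: right_end_def supporting_def)
  qed
qed (use assms in \<open>auto simp: right_end_def\<close>)

text \<open>One half of Dumas' theorem: left ends add up, and so do right ends. Thus an edge of
  \<open>g\<close> forces an edge of the same slope in the product, at least as long.\<close>

lemma edge_of_factor:
  assumes "supporting g lam i" "supporting g lam j" "i < j" "h \<noteq> 0"
  obtains i' j' where "supporting (g * h) lam i'" "supporting (g * h) lam j'" "i' < j'"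
proof -
  have "g \<noteq> 0" using assms(1) by (auto simp: supporting_def)
  then obtain k l where kl: "left_end g lam k" "right_end g lam l" by (rule ends_exist)
  obtain k' l' where kl': "left_end h lam k'" "right_end h lam l'"
    using \<open>h \<noteq> 0\<close> by (rule ends_exist)
  have "k \<le> i"
    using kl(1) assms(1) unfolding left_end_def supporting_def by (meson linorder_not_le)
  moreover have "j \<le> l"
    using kl(2) assms(2) unfolding right_end_def supporting_def by (meson linorder_not_le)
  moreover have "k' \<le> l'"
    using kl' unfolding left_end_def right_end_def supporting_def by (meson linorder_not_le)
  ultimately have "k + k' < l + l'" using assms(3) by linarith
  thus ?thesis
    using that supporting_mult_left[OF kl(1) kl'(1)] supporting_mult_right[OF kl(2) kl'(2)] by blast
qed

text \<open>A sufficiently steep line touches the polygon only at its last vertex; this starts the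
  walk along the vertices.\<close>

lemma steep_left_end_degree:
  assumes "g \<noteq> 0"
  obtains lam where "left_end g lam (degree g)"
proof -
  define d where "d = degree g"
  define B where "B = Max ((\<lambda>i. \<bar>v (coeff g i)\<bar>) ` {..d})"
  have B: "\<bar>v (coeff g i)\<bar> \<le> B" if "i \<le> d" for i
    unfolding B_def using that by (intro Max_ge) auto
  \<comment> \<open>Two valuations differ by at most \<open>2 * B\<close>, so a rise of
    \<open>2 * B + 1\<close> per unit step outweighs any difference.\<close>
  define lam :: real where "lam = - (2 * B + 1)"
  have "height g lam d < height g lam i" if i: "i < d" for i
  proof -
    define t where "t = (2 * B + 1) * (int d - int i)"
    have "(2 * B + 1) * 1 \<le> t"
      unfolding t_def using B[of i] i by (intro mult_left_mono) auto
    moreover have "\<bar>v (coeff g i)\<bar> \<le> B" "\<bar>v (coeff g d)\<bar> \<le> B" using B i by auto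
    ultimately have "v (coeff g d) < v (coeff g i) + t" by (simp add: abs_le_iff)
    hence "real_of_int (v (coeff g d)) < real_of_int (v (coeff g i) + t)"
      by (simp only: of_int_less_iff)
    thus ?thesis by (simp add: height_def lam_def t_def algebra_simps)
  qed
  moreover have "i \<le> d" if "coeff g i \<noteq> 0" for i using that by (simp add: d_def le_degree)
  moreover have "coeff g d \<noteq> 0" using assms by (simp add: d_def)
  ultimately have "left_end g lam d"
    unfolding left_end_def supporting_def by (metis le_less order_refl)
  thus ?thesis using that by (simp add: d_def)
qed

text \<open>From the vertex at \<open>k\<close> one passes to the next vertex on the left.\<close>

lemma next_vertex:
  assumes "left_end g lam k" "k > 0" "coeff g 0 \<noteq> 0"
  obtains mu j where "left_end g mu j" "supporting g mu k" "j < k"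
proof -
  define S where "S = {i. i < k \<and> coeff g i \<noteq> 0}"
  \<comment> \<open>\<open>s i\<close> is the negated slope of the segment from \<open>i\<close> to
    \<open>k\<close>. As \<open>lam\<close> grows, the line turns about the vertex at
    \<open>k\<close>; the minimum \<open>mu\<close> is where it first meets a point on the
    left.\<close>
  define s where "s i = (real_of_int (v (coeff g i)) - v (coeff g k)) / (real k - real i)" for i
  define mu where "mu = Min (s ` S)"
  have S: "finite S" "0 \<in> S" using assms by (auto simp: S_def)
  hence "mu \<in> s ` S" unfolding mu_def by (intro Min_in) auto
  then obtain i0 where i0: "i0 \<in> S" "mu = s i0" by auto
  have ck: "coeff g k \<noteq> 0" using assms by (auto simp: left_end_def supporting_def)
  have gt: "lam < s i" if "i \<in> S" for i
  proof -
    have "height g lam k < height g lam i" using assms that by (auto simp: left_end_def S_def)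
    hence "lam * (real k - real i) < real_of_int (v (coeff g i)) - v (coeff g k)"
      by (simp add: height_def algebra_simps)
    thus ?thesis using that by (simp add: s_def S_def pos_less_divide_eq)
  qed
  have below: "height g mu k \<le> height g mu i" if "i \<in> S" for i
  proof -
    have "mu \<le> s i" unfolding mu_def using S that by (intro Min_le) auto
    hence "mu * (real k - real i) \<le> real_of_int (v (coeff g i)) - v (coeff g k)"
      using that by (simp add: s_def S_def pos_le_divide_eq)
    thus ?thesis by (simp add: height_def algebra_simps)
  qed
  have eq: "height g mu i0 = height g mu k"
  proof -
    have "real k - real i0 \<noteq> 0" using i0 by (simp add: S_def)
    hence "mu * (real k - real i0) = real_of_int (v (coeff g i0)) - v (coeff g k)"
      using i0 by (simp add: s_def)
    thus ?thesis by (simp add: height_def algebra_simps)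
  qed
  \<comment> \<open>Passing from \<open>lam\<close> to the larger \<open>mu\<close> raises heights
    to the right of \<open>k\<close> more than the height at \<open>k\<close>.\<close>
  have above: "height g mu k \<le> height g mu i" if "i > k" "coeff g i \<noteq> 0" for i
  proof -
    have "height g lam k \<le> height g lam i"
      using assms that by (auto simp: left_end_def supporting_def)
    moreover have "(mu - lam) * real k \<le> (mu - lam) * real i"
      using gt[OF i0(1)] i0(2) that by (intro mult_left_mono) auto
    ultimately show ?thesis by (simp add: height_def algebra_simps)
  qed
  have sk: "supporting g mu k"
    unfolding supporting_def using ck below above by (auto simp: S_def) (metis linorder_neqE_nat order_refl)
  have "g \<noteq> 0" using ck by auto
  \<comment> \<open>Several points may lie on the new edge, so its left end is taken instead of
    \<open>i0\<close>; it is at most \<open>i0\<close>, hence left of \<open>k\<close>.\<close>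
  then obtain j j' where j: "left_end g mu j" "right_end g mu j'" by (rule ends_exist)
  have "height g mu j \<le> height g mu k"
    using j(1) ck by (simp add: left_end_def supporting_def)
  hence "\<not> height g mu j < height g mu i0" "coeff g i0 \<noteq> 0" "i0 < k"
    using eq i0 sk j(1) by (auto simp: S_def supporting_def left_end_def)
  moreover have "height g mu i0 \<le> height g mu j"
    using eq sk j(1) by (auto simp: supporting_def left_end_def)
  ultimately have "j < k"
    using j(1) unfolding left_end_def by (metis leI less_le_trans)
  thus ?thesis using that j(1) sk by blast
qed

text \<open>The degree is the sum of the horizontal lengths of the edges of \<open>g\<close>. Each
  edge has an integral rise and a slope shared with \<open>g * h\<close>; the assumption
  \<open>slopes\<close>, saying that \<open>q\<close> divides the denominators of these slopes, then
  makes \<open>q\<close> divide each length.\<close>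

lemma dvd_degree_factor:
  assumes "g \<noteq> 0" "h \<noteq> 0" "coeff g 0 \<noteq> 0"
    and slopes: "\<And>lam i j d. supporting (g * h) lam i \<Longrightarrow> supporting (g * h) lam j \<Longrightarrow> i < j \<Longrightarrow>
        lam * real d \<in> \<int> \<Longrightarrow> q dvd d"
  shows "q dvd degree g"
proof -
  have "q dvd k" if "left_end g lam k" for lam k
    using that
  proof (induction k arbitrary: lam rule: less_induct)
    case (less k)
    show ?case
    proof (cases "k = 0")
      case False
      then obtain mu j where j: "left_end g mu j" "supporting g mu k" "j < k"
        using next_vertex[OF less.prems] assms by blast
      have "supporting g mu j" using j(1) by (simp add: left_end_def)
      have "height g mu j = height g mu k"
        using j(1,2) by (auto simp: left_end_def supporting_def intro: antisym)
      hence "mu * real (k - j) = of_int (v (coeff g j) - v (coeff g k))"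
        using j(3) by (simp add: height_def of_nat_diff algebra_simps)
      hence "mu * real (k - j) \<in> \<int>" by simp
      moreover obtain i' j' where "supporting (g * h) mu i'" "supporting (g * h) mu j'" "i' < j'"
        using \<open>supporting g mu j\<close> j(2,3) \<open>h \<noteq> 0\<close> by (rule edge_of_factor)
      ultimately have "q dvd k - j" using slopes by metis
      moreover have "q dvd j" using less.IH[OF j(3,1)] .
      ultimately show ?thesis using j(3) by (auto intro: dvd_diffD)
    qed simp
  qed
  thus ?thesis using steep_left_end_degree[OF assms(1)] by blast
qed

end

section \<open>The \<open>p\<close>-adic valuation of the rationals\<close>

definition padic_val :: "nat \<Rightarrow> rat \<Rightarrow> int" where
  "padic_val p x =
     int (multiplicity (int p) (fst (quotient_of x))) - int (multiplicity (int p) (snd (quotient_of x)))"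

lemma padic_val_divide:
  assumes "prime p" "a \<noteq> 0" "b \<noteq> 0"
  shows "padic_val p (of_int a / of_int b) = int (multiplicity (int p) a) - int (multiplicity (int p) b)"
proof -
  obtain c d where q: "quotient_of (of_int a / of_int b) = (c, d)" by fastforce
  have d: "d > 0" using q quotient_of_denom_pos by blast
  have eq: "(of_int a / of_int b :: rat) = of_int c / of_int d" using q by (rule quotient_of_div)
  hence c: "c \<noteq> 0" using assms d by auto
  have "(of_int (a * d) :: rat) = of_int (c * b)"
    using eq assms d by (simp add: field_simps)
  hence "a * d = c * b" by (simp only: of_int_eq_iff)
  hence "multiplicity (int p) (a * d) = multiplicity (int p) (c * b)" by simp
  hence "multiplicity (int p) a + multiplicity (int p) d = multiplicity (int p) c + multiplicity (int p) b"
    using assms c d by (simp add: prime_elem_multiplicity_mult_distrib)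
  thus ?thesis by (simp add: padic_val_def q)
qed

lemma padic_val_divide_nat:
  assumes "prime p" "a \<noteq> 0" "b \<noteq> 0"
  shows "padic_val p (of_nat a / of_nat b) = int (multiplicity p a) - int (multiplicity p b)"
proof -
  have "multiplicity (int p) (int c) = multiplicity p c" if "c \<noteq> 0" for c
  proof -
    have "int (p ^ m) dvd int c \<longleftrightarrow> p ^ m dvd c" for m by (rule of_nat_dvd_iff)
    moreover have "\<not> is_unit p" "\<not> is_unit (int p)" using assms(1) not_prime_unit by auto
    ultimately have "m \<le> multiplicity (int p) (int c) \<longleftrightarrow> m \<le> multiplicity p c" for m
      using that by (simp flip: power_dvd_iff_le_multiplicity)
    thus ?thesis by (metis antisym order_refl)
  qed
  thus ?thesis using padic_val_divide[of p "int a" "int b"] assms by simp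
qed

lemma int_valuation_padic_val:
  assumes p: "prime p"
  shows "int_valuation (padic_val p)"
proof
  fix x y :: rat assume xy: "x \<noteq> 0" "y \<noteq> 0"
  obtain a b c d where x: "x = of_int a / of_int b" "b \<noteq> 0" and y: "y = of_int c / of_int d" "d \<noteq> 0"
    by (metis quotient_of_denom_pos quotient_of_div surj_pair less_irrefl)
  have ac: "a \<noteq> 0" "c \<noteq> 0" using xy x y by auto
  note vd = padic_val_divide[OF p]
  have "x * y = of_int (a * c) / of_int (b * d)" using x y by simp
  thus "padic_val p (x * y) = padic_val p x + padic_val p y"
    using p x y ac by (simp only: vd x(1) y(1) mult_eq_0_iff simp_thms) (simp add: prime_elem_multiplicity_mult_distrib)
  assume s: "x + y \<noteq> 0"
  have "x + y = of_int (a * d + c * b) / of_int (b * d)" using x y by (simp add: field_simps)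
  moreover have ne: "a * d + c * b \<noteq> 0" using calculation s by (metis div_0 of_int_0)
  ultimately have vs: "padic_val p (x + y) =
      int (multiplicity (int p) (a * d + c * b)) - int (multiplicity (int p) (b * d))"
    using vd[of "a * d + c * b" "b * d"] x(2) y(2) by (simp only: mult_eq_0_iff) simp
  have "min (multiplicity (int p) (a * d)) (multiplicity (int p) (c * b)) \<le>
        multiplicity (int p) (a * d + c * b)" (is "?m \<le> _")
  proof (rule multiplicity_geI)
    show "int p ^ ?m dvd a * d + c * b"
      by (intro dvd_add) (auto intro: multiplicity_dvd')
  qed (use p ne in \<open>auto simp: prime_gt_1_nat\<close>)
  moreover have "padic_val p x = int (multiplicity (int p) a) - int (multiplicity (int p) b)"
    "padic_val p y = int (multiplicity (int p) c) - int (multiplicity (int p) d)"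
    using vd x y ac by auto
  ultimately show "min (padic_val p x) (padic_val p y) \<le> padic_val p (x + y)"
    using p x y ac unfolding vs by (simp add: prime_elem_multiplicity_mult_distrib)
qed

section \<open>Valuations of factorials\<close>

definition fact_val :: "nat \<Rightarrow> nat \<Rightarrow> nat" where
  "fact_val p n = multiplicity p (fact n :: nat)"

lemma fact_val_0 [simp]: "fact_val p 0 = 0"
  by (simp add: fact_val_def)

lemma fact_val_Suc: "prime p \<Longrightarrow> fact_val p (Suc n) = multiplicity p (Suc n) + fact_val p n"
  unfolding fact_val_def fact_Suc by (subst prime_elem_multiplicity_mult_distrib) auto

lemma fact_val_mono: "prime p \<Longrightarrow> m \<le> n \<Longrightarrow> fact_val p m \<le> fact_val p n"
  by (rule lift_Suc_mono_le[of "fact_val p"]) (simp add: fact_val_Suc)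

text \<open>One step of Legendre's formula: only the multiples of \<open>p\<close> contribute, and
  removing one \<open>p\<close> from each leaves the factorial of \<open>n div p\<close>.\<close>

lemma fact_val_div:
  assumes "prime p"
  shows "fact_val p n = n div p + fact_val p (n div p)"
proof (induction n)
  case (Suc n)
  have p: "p > 0" using assms by (simp add: prime_gt_0_nat)
  show ?case
  proof (cases "p dvd Suc n")
    case True
    hence "Suc n div p = Suc (n div p)" by (simp add: div_Suc dvd_eq_mod_eq_0)
    moreover have "multiplicity p (p * (Suc n div p)) = Suc (multiplicity p (Suc n div p))"
      using True p assms by (intro multiplicity_times_same) (auto simp: dvd_div_eq_0_iff)
    hence "multiplicity p (Suc n) = Suc (multiplicity p (Suc n div p))" using True by simp
    ultimately show ?thesis using Suc assms by (simp add: fact_val_Suc)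
  next
    case False
    hence "Suc n div p = n div p" by (simp add: div_Suc dvd_eq_mod_eq_0)
    thus ?thesis using Suc False assms by (simp add: fact_val_Suc not_dvd_imp_multiplicity_0)
  qed
qed simp

lemma fact_val_add_le: "prime p \<Longrightarrow> fact_val p m + fact_val p n \<le> fact_val p (m + n)"
proof -
  assume p: "prime p"
  have "fact_val p m + fact_val p n = multiplicity p (fact m * fact n :: nat)"
    unfolding fact_val_def using p by (subst prime_elem_multiplicity_mult_distrib) auto
  also have "\<dots> \<le> fact_val p (m + n)"
    unfolding fact_val_def by (rule dvd_imp_multiplicity_le) (auto simp: fact_fact_dvd_fact)
  finally show ?thesis .
qed

lemma multiplicity_choose:
  assumes "prime p"
  shows "multiplicity p ((m + n) choose n) + fact_val p m + fact_val p n = fact_val p (m + n)"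
proof -
  have "fact n * fact m * ((m + n) choose n) = (fact (m + n) :: nat)"
    using binomial_fact_lemma[of n "m + n"] by simp
  hence "fact_val p (m + n) = multiplicity p (fact n * fact m * ((m + n) choose n))"
    by (simp add: fact_val_def)
  thus ?thesis using assms by (simp add: prime_elem_multiplicity_mult_distrib fact_val_def)
qed

text \<open>The numbers \<open>m\<close> and \<open>n\<close> are added without carries in base \<open>p\<close> (Kummer).\<close>

definition carry_free :: "nat \<Rightarrow> nat \<Rightarrow> nat \<Rightarrow> bool" where
  "carry_free p m n \<longleftrightarrow> fact_val p (m + n) = fact_val p m + fact_val p n"

text \<open>Legendre's recursion peels off the last digit. A carry there adds one to the quotient of
  the sum, and superadditivity of \<open>fact_val\<close> then makes the inequality strict.\<close>

lemma carry_free_iff: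
  assumes p: "prime p"
  shows "carry_free p m n \<longleftrightarrow> m mod p + n mod p < p \<and> carry_free p (m div p) (n div p)"
proof (cases "m mod p + n mod p < p")
  case True
  hence "(m mod p + n mod p) div p = 0" by (rule div_less)
  hence "(m + n) div p = m div p + n div p" using div_add1_eq[of m n p] by linarith
  thus ?thesis using True fact_val_div[OF p, of "m + n"] fact_val_div[OF p, of m] fact_val_div[OF p, of n]
    unfolding carry_free_def by auto
next
  case False
  have "m mod p < p" "n mod p < p" using p by (simp_all add: prime_gt_0_nat)
  hence "m mod p + n mod p < p + p" by (rule add_strict_mono)
  hence "(m mod p + n mod p) div p = 1"
    using False by (intro div_nat_eqI) simp_all
  hence eq: "(m + n) div p = Suc (m div p + n div p)" using div_add1_eq[of m n p] by linarith
  have "fact_val p (m div p) + fact_val p (n div p) \<le> fact_val p (m div p + n div p)"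
    by (rule fact_val_add_le[OF p])
  also have "\<dots> \<le> fact_val p (Suc (m div p + n div p))"
    by (rule fact_val_mono[OF p]) simp
  finally have "fact_val p m + fact_val p n < fact_val p (m + n)"
    using fact_val_div[OF p, of "m + n", unfolded eq] fact_val_div[OF p, of m] fact_val_div[OF p, of n]
    by linarith
  thus ?thesis using False by (simp add: carry_free_def)
qed

text \<open>
  The Newton polygon of the truncated exponential series of degree \<open>n\<close>: a supporting line either has
  one of the slopes \<open>(p ^ T - 1) / ((p - 1) * p ^ T)\<close>, or meets the polygon in a single vertex.
  The induction removes the last base-\<open>p\<close> digit, which replaces the slope \<open>lam\<close> by \<open>p * lam - 1\<close>.
\<close>

lemma fact_val_unique_min:
  fixes lam :: real
  assumes p: "prime p" and "carry_free p n r"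
  shows "(\<exists>T. lam * (real p - 1) * real p ^ T = real p ^ T - 1 \<and> \<not> p dvd n div p ^ T) \<or>
    (\<exists>k\<le>n. carry_free p (n - k) r \<and>
       (\<forall>j\<le>n. j \<noteq> k \<longrightarrow> lam * k - fact_val p k < lam * j - fact_val p j))"
    (is "?edge lam n \<or> ?vertex lam n r")
  using assms(2)
proof (induction n arbitrary: r lam rule: less_induct)
  case (less n)
  have p1: "p > 1" using p by (rule prime_gt_1_nat)
  have free0: "carry_free p 0 r" for r by (simp add: carry_free_def)
  consider "n = 0" | "lam < 0" | "lam = 0" "n > 0" "p dvd n" | "lam = 0" "\<not> p dvd n"
    | "lam > 0" "n > 0" by (cases "n = 0"; cases "p dvd n"; cases lam "0::real" rule: linorder_cases) auto
  thus ?case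
  proof cases
    case 1
    thus ?thesis using less.prems by auto
  next
    case 2
    have "lam * n - fact_val p n < lam * j - fact_val p j" if "j \<le> n" "j \<noteq> n" for j
    proof -
      have "lam * n < lam * j" using 2 that by simp
      moreover have "real (fact_val p j) \<le> fact_val p n" using fact_val_mono[OF p] that by simp
      ultimately show ?thesis by linarith
    qed
    thus ?thesis using free0 by (intro disjI2 exI[of _ n]) auto
  next
    \<comment> \<open>The factor \<open>n\<close> of \<open>fact n\<close> is divisible by
      \<open>p\<close>, so the valuation jumps at \<open>n\<close> itself and \<open>n\<close> is
      the unique minimum.\<close>
    case 3
    then obtain m where m: "n = Suc m" by (cases n) auto
    have "fact_val p j < fact_val p n" if "j \<le> n" "j \<noteq> n" for j
    proof -
      have "fact_val p j \<le> fact_val p m" using that m by (intro fact_val_mono p) auto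
      also have "\<dots> < fact_val p n"
        using 3 p p1 unfolding m by (simp add: fact_val_Suc multiplicity_gt_zero_iff)
      finally show ?thesis .
    qed
    thus ?thesis using 3 free0 by (intro disjI2 exI[of _ n]) auto
  next
    \<comment> \<open>Slope 0 is the edge belonging to the nonzero last digit,
      \<open>T = 0\<close>.\<close>
    case 4
    thus ?thesis by (intro disjI1 exI[of _ 0]) auto
  next
    case 5
    define n' r' where "n' = n div p" and "r' = r div p"
    have free: "n mod p + r mod p < p" "carry_free p n' r'"
      using less.prems carry_free_iff[OF p, of n r] by (simp_all only: n'_def r'_def)
    have "n' < n" using 5 p1 by (simp add: n'_def)
    from less.IH[OF this free(2), of "p * lam - 1"]
    show ?thesis
    proof
      assume "?edge (p * lam - 1) n'"
      then obtain T where T: "(p * lam - 1) * (real p - 1) * real p ^ T = real p ^ T - 1"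
        "\<not> p dvd n' div p ^ T" by blast
      have "lam * (real p - 1) * real p ^ Suc T = real p ^ Suc T - 1"
        using T(1) by (simp add: algebra_simps)
      moreover have "n div p ^ Suc T = n' div p ^ T" by (simp add: n'_def div_mult2_eq)
      ultimately show ?thesis using T(2) by metis
    next
      assume "?vertex (p * lam - 1) n' r'"
      then obtain k where k: "k \<le> n'" "carry_free p (n' - k) r'"
        and min: "\<And>j. j \<le> n' \<Longrightarrow> j \<noteq> k \<Longrightarrow>
          (p * lam - 1) * k - fact_val p k < (p * lam - 1) * j - fact_val p j" by blast
      have n: "n = p * n' + n mod p" by (simp add: n'_def)
      have pk: "p * k \<le> p * n'" using k by simp
      \<comment> \<open>Subtracting a multiple of \<open>p\<close> keeps the last digit of
        \<open>n\<close>, so the addition of \<open>r\<close> still has no carry there.\<close>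
      hence "n - p * k = p * (n' - k) + n mod p" using n by (simp add: diff_mult_distrib2)
      hence "(n - p * k) div p = n' - k" "(n - p * k) mod p = n mod p" using p1 by auto
      hence "carry_free p (n - p * k) r"
        using free(1) k(2) unfolding carry_free_iff[OF p, of "n - p * k" r] by (simp add: r'_def)
      moreover have "lam * real (p * k) - fact_val p (p * k) < lam * j - fact_val p j"
        if j: "j \<le> n" "j \<noteq> p * k" for j
      proof -
        define j' c where "j' = j div p" and "c = j mod p"
        have jc: "j = p * j' + c" by (simp add: j'_def c_def)
        have j': "j' \<le> n'" using j by (simp add: j'_def n'_def div_le_mono)
        \<comment> \<open>The last digit \<open>c\<close> of \<open>j\<close> costs
          \<open>lam * c\<close>, positive unless \<open>c = 0\<close>; the minimum is thus attained
          at a multiple of \<open>p\<close>.\<close>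
        have "lam * j - fact_val p j = (p * lam - 1) * j' - fact_val p j' + lam * c"
        proof -
          have "fact_val p j = j' + fact_val p j'"
            unfolding j'_def by (rule fact_val_div[OF p])
          moreover have "real j = p * j' + c" using jc by simp
          ultimately show ?thesis by (simp add: algebra_simps)
        qed
        moreover have "lam * real (p * k) - fact_val p (p * k) = (p * lam - 1) * k - fact_val p k"
          using fact_val_div[OF p, of "p * k"] p1 by (simp add: algebra_simps)
        moreover have "0 \<le> lam * c" using 5 by simp
        moreover have "0 < lam * c" if "j' = k" using that 5 j jc by simp
        ultimately show ?thesis using min[OF j'] by (cases "j' = k") auto
      qed
      moreover have "p * k \<le> n" using pk n by linarith
      ultimately show ?thesis by (intro disjI2 exI[of _ "p * k"]) auto
    qed
  qed
qed

section \<open>Irreducibility\<close>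

lemma coeff_gen_laguerre:
  "coeff (gen_laguerre n r) j =
     (if j \<le> n then of_nat ((n - j + r) choose r) / of_nat (fact j) else 0)"
proof -
  have "(n - j + r) choose (n - j) = (n - j + r) choose r"
    using binomial_symmetric[of r "n - j + r"] by simp
  moreover have "coeff (gen_laguerre n r) j =
      (if j \<le> n then of_nat ((n - j + r) choose (n - j)) / fact j else 0)"
    by (simp add: gen_laguerre_def coeff_sum)
  ultimately show ?thesis by (simp del: Nat.add_diff_assoc2)
qed

lemma degree_gen_laguerre: "degree (gen_laguerre n r) = n"
proof (rule antisym)
  show "degree (gen_laguerre n r) \<le> n" by (rule degree_le) (simp add: coeff_gen_laguerre)
  show "n \<le> degree (gen_laguerre n r)" by (rule le_degree) (simp add: coeff_gen_laguerre)
qed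

lemma padic_val_coeff_gen_laguerre:
  assumes "prime p" "j \<le> n"
  shows "padic_val p (coeff (gen_laguerre n r) j) =
    int (fact_val p (n - j + r)) - int (fact_val p (n - j)) - int (fact_val p r) - int (fact_val p j)"
proof -
  have "padic_val p (coeff (gen_laguerre n r) j) =
      int (multiplicity p ((n - j + r) choose r)) - int (fact_val p j)"
    using assms by (simp only: coeff_gen_laguerre if_True, subst padic_val_divide_nat)
      (auto simp: fact_val_def)
  thus ?thesis using multiplicity_choose[OF assms(1), of "n - j" r] by linarith
qed

text \<open>The points lie on or above those of the truncated exponential series, with equality
  where \<open>n - k\<close> and \<open>r\<close> add without carry. Hence a line meeting the
  exponential polygon only in such a vertex meets this one only there as well, and every edge has an
  exponential slope.\<close>

lemma gen_laguerre_slopes: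
  assumes p: "prime p" and "p ^ m dvd n" and free: "carry_free p n r"
    and "int_valuation.supporting (padic_val p) (gen_laguerre n r) lam i"
    and "int_valuation.supporting (padic_val p) (gen_laguerre n r) lam j"
    and "i < j" and "lam * real d \<in> \<int>"
  shows "p ^ m dvd d"
proof -
  interpret int_valuation "padic_val p" using p by (rule int_valuation_padic_val)
  let ?f = "gen_laguerre n r"
  have nz: "coeff ?f k \<noteq> 0 \<longleftrightarrow> k \<le> n" for k by (auto simp: coeff_gen_laguerre)
  have lower: "lam * k - fact_val p k \<le> height ?f lam k" if "k \<le> n" for k
  proof -
    have "int (fact_val p (n - k)) + int (fact_val p r) \<le> int (fact_val p (n - k + r))"
      using fact_val_add_le[OF p, of "n - k" r] by linarith
    hence "- int (fact_val p k) \<le> padic_val p (coeff ?f k)"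
      using padic_val_coeff_gen_laguerre[OF p that, of r] by linarith
    thus ?thesis unfolding height_def by linarith
  qed
  have exact: "lam * k - fact_val p k = height ?f lam k" if "k \<le> n" "carry_free p (n - k) r" for k
    using that by (simp add: height_def padic_val_coeff_gen_laguerre[OF p] carry_free_def)
  have not_vertex: False if k: "k \<le> n" "carry_free p (n - k) r"
    and min: "\<forall>j\<le>n. j \<noteq> k \<longrightarrow> lam * k - fact_val p k < lam * j - fact_val p j" for k
  proof -
    have "l = k" if "supporting ?f lam l" for l
    proof (rule ccontr)
      assume "l \<noteq> k"
      moreover have l: "l \<le> n" "height ?f lam l \<le> height ?f lam k"
        using that k nz by (auto simp: supporting_def)
      ultimately show False using min lower[OF l(1)] exact[OF k] by fastforce
    qed
    thus False using assms(4-6) by blast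
  qed
  obtain T where T: "lam * (real p - 1) * real p ^ T = real p ^ T - 1" "\<not> p dvd n div p ^ T"
    using fact_val_unique_min[OF p free, of lam] not_vertex by blast
  \<comment> \<open>The digit of \<open>n\<close> at place \<open>T\<close> is nonzero, whereas the
    lowest \<open>m\<close> digits vanish.\<close>
  have "m \<le> T"
  proof (rule ccontr)
    assume "\<not> m \<le> T"
    hence "p ^ Suc T dvd n" by (meson assms(2) dvd_trans le_imp_power_dvd not_less_eq_eq)
    hence "p dvd n div p ^ T" by (auto elim!: dvdE simp: mult.assoc)
    thus False using T(2) by blast
  qed
  obtain z where z: "lam * real d = of_int z" using assms(7) by (auto elim: Ints_cases)
  have "real_of_int (z * (int p - 1) * int p ^ T) = (lam * (real p - 1) * real p ^ T) * d"
    using z by simp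
  also have "\<dots> = real_of_int ((int p ^ T - 1) * int d)" unfolding T(1) by simp
  finally have "z * (int p - 1) * int p ^ T = (int p ^ T - 1) * int d"
    by (simp only: of_int_eq_iff)
  \<comment> \<open>Solving for \<open>d\<close> exhibits it as a multiple of
    \<open>p ^ T\<close>.\<close>
  hence "int d = int p ^ T * (int d - z * (int p - 1))" by (simp add: algebra_simps)
  hence "int p ^ T dvd int d" by (metis dvd_triv_left)
  hence "p ^ T dvd d" by (metis of_nat_dvd_iff of_nat_power)
  thus ?thesis using \<open>m \<le> T\<close> by (meson dvd_trans le_imp_power_dvd)
qed

lemma irreducible_gen_laguerre:
  assumes "n \<ge> 1" "coprime n ((n + r) choose r)"
  shows "irreducible (gen_laguerre n r)"
proof -
  let ?f = "gen_laguerre n r"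
  have deg: "n dvd degree g" if gh: "?f = g * h" for g h
  proof -
    have f0: "coeff ?f 0 \<noteq> 0" by (simp add: coeff_gen_laguerre)
    hence g0: "coeff g 0 \<noteq> 0" by (auto simp: gh coeff_mult)
    hence "g \<noteq> 0" "h \<noteq> 0" using f0 gh by auto
    have dvd: "p ^ multiplicity p n dvd degree g" if p: "prime p" for p
    proof (cases "p dvd n")
      case True
      hence "\<not> p dvd ((n + r) choose r)"
        using assms(2) p by (meson coprime_common_divisor not_prime_unit)
      hence free: "carry_free p n r"
        using multiplicity_choose[OF p, of n r] by (simp add: not_dvd_imp_multiplicity_0 carry_free_def)
      interpret int_valuation "padic_val p" using p by (rule int_valuation_padic_val)
      show ?thesis
        using \<open>g \<noteq> 0\<close> \<open>h \<noteq> 0\<close> g0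
      proof (rule dvd_degree_factor)
        fix lam i j d
        assume "supporting (g * h) lam i" "supporting (g * h) lam j" "i < j" "lam * real d \<in> \<int>"
        thus "p ^ multiplicity p n dvd d"
          unfolding gh[symmetric] by (rule gen_laguerre_slopes[OF p multiplicity_dvd free])
      qed
    qed (simp add: not_dvd_imp_multiplicity_0)
    show ?thesis
    proof (cases "degree g = 0")
      case False
      show ?thesis
      proof (rule multiplicity_le_imp_dvd)
        fix p :: nat assume p: "prime p"
        show "multiplicity p n \<le> multiplicity p (degree g)"
          using dvd[OF p] False p by (intro multiplicity_geI) (auto simp: not_prime_unit)
      qed (use assms in auto)
    qed simp
  qed
  show ?thesis
  proof (rule irreducibleI)
    have d: "degree ?f \<noteq> 0" using assms by (simp add: degree_gen_laguerre)
    show "?f \<noteq> 0" using d by auto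
    show "\<not> ?f dvd 1" using d is_unit_iff_degree[OF \<open>?f \<noteq> 0\<close>] by simp
    fix g h assume gh: "?f = g * h"
    hence ne: "g \<noteq> 0" "h \<noteq> 0" using \<open>?f \<noteq> 0\<close> by auto
    have "degree g + degree h = n"
      using degree_mult_eq[OF ne] gh degree_gen_laguerre by metis
    \<comment> \<open>A multiple of \<open>n\<close> not exceeding \<open>n\<close> is 0 or
      \<open>n\<close>, so one of the factors is constant.\<close>
    moreover have "n dvd degree g" using deg[OF gh] .
    ultimately have "degree g = 0 \<or> degree h = 0"
      by (cases "degree g = 0") (auto dest: dvd_imp_le)
    thus "g dvd 1 \<or> h dvd 1" using ne by (simp add: is_unit_iff_degree)
  qed
qed

text \<open>A prime divisor \<open>p\<close> of \<open>n\<close> exceeds \<open>r\<close>, so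
  \<open>r\<close> is a single digit added to the final digit 0 of \<open>n\<close>: no carry
  occurs.\<close>

lemma coprime_fact_imp_coprime_choose:
  fixes n r :: nat
  assumes "coprime n (fact r)"
  shows "coprime n ((n + r) choose r)"
proof (rule ccontr)
  assume "\<not> coprime n ((n + r) choose r)"
  then obtain p where p: "prime p" "p dvd n" "p dvd ((n + r) choose r)"
    unfolding coprime_iff_gcd_eq_1 by (metis prime_factor_nat gcd_greatest_iff)
  have "\<not> p dvd fact r" using assms p by (meson coprime_common_divisor not_prime_unit)
  hence "r < p" using p by (simp add: prime_dvd_fact_iff)
  hence "carry_free p n r"
    using p by (subst carry_free_iff) (auto simp: carry_free_def)
  hence "multiplicity p ((n + r) choose r) = 0"
    using multiplicity_choose[OF p(1), of n r] by (simp add: carry_free_def)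
  moreover have "(n + r) choose r \<noteq> 0" "\<not> is_unit p" using p(1) not_prime_unit by auto
  ultimately show False using p(3) multiplicity_eq_zero_iff by blast
qed

theorem theorem2p10:
  fixes n r :: nat
  assumes "n \<ge> 1"
  shows "(gcd n ((n + r) choose r) = 1 \<longrightarrow> irreducible (gen_laguerre n r)) \<and>
    (gcd n (fact r) = 1 \<longrightarrow> irreducible (gen_laguerre n r))"
  unfolding coprime_iff_gcd_eq_1[symmetric]
  using irreducible_gen_laguerre[OF assms] coprime_fact_imp_coprime_choose by blast

end
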